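(* For every integer $n\ge 6$ we have $b_3(n)\le \lceil n/2\rceil< f_3(n)$. Moreover, $b_4(n)<f_4(n)$ for all sufficiently large $n$.
   Context: For $r\ge 2$, $K_n^{(r)}$ denotes the collection of all $r$-element subsets of an $n$-element vertex set. A complete $r$-partite $r$-graph (on this vertex set) is specified by $r$ pairwise disjoint sets $A_1,\ldots,A_r$ of vertices, and consists of those $r$-sets that meet every $A_i$. The sets $A_1,\ldots,A_r$ need not cover the vertex set. A set of complete $r$-partite $r$-graphs is an odd cover of $K_n^{(r)}$ if each $r$-set is in an odd number of these complete $r$-partite $r$-graphs. The odd cover number $b_r(n)$ is the smallest size of an odd cover of $K_n^{(r)}$. The partition number $f_r(n)$ is the minimum number of complete $r$-partite $r$-graphs needed to partition the edge set of $K_n^{(r)}$, i.e. so that each $r$-set is in exactly one of them. *)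

theory Defs
  imports Complex_Main "HOL-Library.Ramsey" "HOL-Library.Disjoint_Sets"
begin

text \<open>An \<open>r\<close>-graph on the vertex set \<open>V\<close> is represented by its set of edges, so that
  \<open>K_n^(r)\<close> is \<open>nsets {..<n} r\<close>.\<close>

definition complete_partite :: "nat \<Rightarrow> 'a set \<Rightarrow> (nat \<Rightarrow> 'a set) \<Rightarrow> 'a set set" where
  "complete_partite r V A = {e \<in> nsets V r. \<forall>i<r. e \<inter> A i \<noteq> {}}"

text \<open>The parts \<open>A i\<close> need not cover \<open>V\<close>. An empty part is allowed and yields the graph without
  edges; such a graph can be dropped from any cover, so it does not affect the minima below.\<close>

definition is_complete_partite :: "nat \<Rightarrow> 'a set \<Rightarrow> 'a set set \<Rightarrow> bool" where
  "is_complete_partite r V H \<longleftrightarrow>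
     (\<exists>A. (\<forall>i<r. A i \<subseteq> V) \<and> disjoint_family_on A {..<r} \<and> H = complete_partite r V A)"

definition odd_cover :: "nat \<Rightarrow> 'a set \<Rightarrow> 'a set set set \<Rightarrow> bool" where
  "odd_cover r V C \<longleftrightarrow> finite C \<and> (\<forall>H\<in>C. is_complete_partite r V H) \<and>
     (\<forall>e\<in>nsets V r. odd (card {H \<in> C. e \<in> H}))"

definition partite_partition :: "nat \<Rightarrow> 'a set \<Rightarrow> 'a set set set \<Rightarrow> bool" where
  "partite_partition r V C \<longleftrightarrow> finite C \<and> (\<forall>H\<in>C. is_complete_partite r V H) \<and>
     (\<forall>e\<in>nsets V r. \<exists>!H. H \<in> C \<and> e \<in> H)"

text \<open>Both minima are over nonempty sets: the graphs with a single edge form a partition.\<close>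

definition odd_cover_number :: "nat \<Rightarrow> nat \<Rightarrow> nat" where
  "odd_cover_number r n = (LEAST k. \<exists>C. odd_cover r {..<n} C \<and> card C = k)"

definition partition_number :: "nat \<Rightarrow> nat \<Rightarrow> nat" where
  "partition_number r n = (LEAST k. \<exists>C. partite_partition r {..<n} C \<and> card C = k)"

end

theory Submission
  imports Defs
begin

text \<open>Odd covers for \<open>r = 3\<close>. On \<open>n = 2m\<close> vertices \<open>(j, b)\<close> with \<open>j < m\<close> and \<open>b\<close> a bit, let the
  \<open>i\<close>-th tripartition have the part \<open>{(i, 0), (i, 1)}\<close> and separate the other vertices by whether
  \<open>b\<close> agrees with \<open>j < i\<close>; every triple is rainbow for one or three values of \<open>i\<close>. The link of a
  vertex then gives an odd cover of \<open>K_n\<close> with about \<open>n/2\<close> bicliques.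

  Odd covers for \<open>r = 4\<close>. Split the vertex set into two halves and combine covers of the halves
  according to how many vertices of an edge lie in each half; then \<open>T(n) = 2T(n/2) + n^2/16 + O(n)\<close>,
  so that \<open>T(n)\<close> is asymptotically at most \<open>n^2/8\<close>; a bound with leading term \<open>n^2/7\<close> suffices.

  Lower bounds. For \<open>r = 2k\<close>, consider \<open>D(y)\<close>, the sum of \<open>y_p y_q\<close> over disjoint \<open>k\<close>-sets \<open>p\<close>
  and \<open>q\<close>. Each complete partite graph of a partition contributes \<open>(2k choose k)\<close> products of two
  linear forms, which all vanish as soon as half of the forms do. If moreover the sum of \<open>y_p\<close>
  over \<open>p \<supseteq> T\<close> vanishes whenever \<open>|T| < k\<close>, then by inclusion-exclusion
  \<open>D(y) = (-1)^k \<Sum> y_p^2\<close>, so \<open>y = 0\<close>: these conditions number at least \<open>(n choose k)\<close>. This gives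
  roughly \<open>n^2/6\<close> for \<open>r = 4\<close>, and for \<open>r = 3\<close> the case \<open>k = 1\<close> applies to the link of a vertex.\<close>

section \<open>Families of complete partite hypergraphs\<close>

definition rainbow :: "nat \<Rightarrow> (nat \<Rightarrow> 'a set) \<Rightarrow> 'a set \<Rightarrow> bool" where
  "rainbow r A e \<longleftrightarrow> (\<forall>i<r. e \<inter> A i \<noteq> {})"

definition parts_in :: "nat \<Rightarrow> 'a set \<Rightarrow> (nat \<Rightarrow> 'a set) \<Rightarrow> bool" where
  "parts_in r V A \<longleftrightarrow> (\<forall>i<r. A i \<subseteq> V) \<and> disjoint_family_on A {..<r}"

text \<open>Lists of part functions keep multiplicities, so the count stays additive when links or
  joins yield the same hypergraph repeatedly.\<close>

definition coverage :: "nat \<Rightarrow> (nat \<Rightarrow> 'a set) list \<Rightarrow> 'a set \<Rightarrow> nat" where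
  "coverage r L e = (\<Sum>A\<leftarrow>L. of_bool (rainbow r A e))"

lemma coverage_Nil [simp]: "coverage r [] e = 0"
  and coverage_Cons [simp]: "coverage r (A # L) e = of_bool (rainbow r A e) + coverage r L e"
  and coverage_append [simp]: "coverage r (L @ M) e = coverage r L e + coverage r M e"
  by (simp_all add: coverage_def)

lemma coverage_concat: "coverage r (concat Ls) e = (\<Sum>L\<leftarrow>Ls. coverage r L e)"
  by (induction Ls) auto

lemma is_complete_partite_iff:
  "is_complete_partite r V H \<longleftrightarrow> (\<exists>A. parts_in r V A \<and> H = complete_partite r V A)"
  by (simp add: is_complete_partite_def parts_in_def)

lemma mem_complete_partite:
  "e \<in> complete_partite r V A \<longleftrightarrow> e \<in> nsets V r \<and> rainbow r A e"
  by (simp add: complete_partite_def rainbow_def)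

text \<open>Picking a point of \<open>e\<close> in each \<open>A i\<close> is injective by
  disjointness; when the cardinalities agree the choice exhausts \<open>e\<close>.\<close>

lemma disjoint_family_on_inter_card:
  assumes "disjoint_family_on A I" "finite e" "\<And>i. i \<in> I \<Longrightarrow> e \<inter> A i \<noteq> {}"
  shows "finite I" "card I \<le> card e" "card I = card e \<Longrightarrow> e \<subseteq> (\<Union>i\<in>I. A i)"
proof -
  have "\<forall>i\<in>I. \<exists>x. x \<in> e \<inter> A i" using assms(3) by blast
  then obtain g where g: "\<And>i. i \<in> I \<Longrightarrow> g i \<in> e \<inter> A i" by metis
  have inj: "inj_on g I"
    using g assms(1) unfolding inj_on_def disjoint_family_on_def by (metis IntE IntI empty_iff)
  have sub: "g ` I \<subseteq> e" using g by auto
  show "finite I" using inj sub assms(2) inj_on_finite by blast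
  show "card I \<le> card e" using inj sub assms(2) by (metis card_image card_mono)
  show "e \<subseteq> (\<Union>i\<in>I. A i)" if "card I = card e"
  proof -
    have "g ` I = e" using sub that inj assms(2) by (metis card_image card_subset_eq)
    then show ?thesis using g by auto
  qed
qed

lemma rainbow_card_le:
  assumes "parts_in r V A" "finite e" "rainbow r A e"
  shows "r \<le> card e"
  using disjoint_family_on_inter_card(2)[of A "{..<r}" e] assms
  by (auto simp: parts_in_def rainbow_def)

subsection \<open>Links\<close>

text \<open>For disjoint parts, \<open>LEAST\<close> finds the only part containing
  \<open>v\<close>; it is deleted and the later indices move down by one. Members without
  \<open>v\<close> in a part are dropped.\<close>

definition link :: "nat \<Rightarrow> 'a \<Rightarrow> (nat \<Rightarrow> 'a set) list \<Rightarrow> (nat \<Rightarrow> 'a set) list" where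
  "link r v L = map (\<lambda>A i. A (if i < (LEAST k. v \<in> A k) then i else Suc i))
     (filter (\<lambda>A. \<exists>k<Suc r. v \<in> A k) L)"

lemma link_member:
  assumes A: "parts_in (Suc r) (insert v V) A" and k: "k < Suc r" "v \<in> A k"
  defines "B \<equiv> \<lambda>i. A (if i < k then i else Suc i)"
  shows "parts_in r V B"
    and "e \<subseteq> V \<Longrightarrow> v \<notin> V \<Longrightarrow> rainbow (Suc r) A (insert v e) \<longleftrightarrow> rainbow r B e"
proof -
  have disj: "A i \<inter> A j = {}" if "i < Suc r" "j < Suc r" "i \<noteq> j" for i j
    using A that by (auto simp: parts_in_def disjoint_family_on_def)
  have notv: "v \<notin> A i" if "i < Suc r" "i \<noteq> k" for i
    using disj[OF that(1) k(1) that(2)] k(2) by blast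
  show "parts_in r V B"
    unfolding parts_in_def disjoint_family_on_def
  proof (intro conjI allI impI ballI)
    fix i assume "i < r"
    then have "v \<notin> B i" using notv k by (auto simp: B_def)
    moreover have "B i \<subseteq> insert v V" using A \<open>i < r\<close> by (auto simp: B_def parts_in_def)
    ultimately show "B i \<subseteq> V" by blast
  next
    fix i j assume "i \<in> {..<r}" "j \<in> {..<r}" "i \<noteq> j"
    then show "B i \<inter> B j = {}" unfolding B_def by (intro disj) auto
  qed
  assume e: "e \<subseteq> V" "v \<notin> V"
  show "rainbow (Suc r) A (insert v e) \<longleftrightarrow> rainbow r B e"
  proof
    assume R: "rainbow (Suc r) A (insert v e)"
    show "rainbow r B e" unfolding rainbow_def
    proof (intro allI impI)
      fix i assume "i < r"
      define j where "j = (if i < k then i else Suc i)"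
      have "j < Suc r" "j \<noteq> k" using \<open>i < r\<close> by (auto simp: j_def)
      then have "insert v e \<inter> A j \<noteq> {}" "v \<notin> A j"
        using R notv[of j] by (auto simp: rainbow_def)
      then have "e \<inter> A j \<noteq> {}" by blast
      then show "e \<inter> B i \<noteq> {}" by (simp add: B_def j_def)
    qed
  next
    assume R: "rainbow r B e"
    show "rainbow (Suc r) A (insert v e)" unfolding rainbow_def
    proof (intro allI impI)
      fix j assume j: "j < Suc r"
      consider "j < k" | "j = k" | "j > k" by linarith
      then show "insert v e \<inter> A j \<noteq> {}"
      proof cases
        case 1
        then have "j < r" using k by simp
        then have "e \<inter> A j \<noteq> {}" using R 1 unfolding rainbow_def B_def by metis
        then show ?thesis by auto
      next
        case 2
        then show ?thesis using k by auto
      next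
        case 3
        then have "j - 1 < r" "\<not> j - 1 < k" "Suc (j - 1) = j" using j by auto
        then have "e \<inter> A j \<noteq> {}" using R unfolding rainbow_def B_def by metis
        then show ?thesis by auto
      qed
    qed
  qed
qed

text \<open>Adding \<open>v\<close> identifies the edges of the link with the edges through
  \<open>v\<close>. As coverage is preserved exactly, this serves both the odd covers and the
  partitions.\<close>

lemma link_family:
  assumes "\<forall>A\<in>set L. parts_in (Suc r) (insert v V) A" "v \<notin> V"
  shows "\<forall>B\<in>set (link r v L). parts_in r V B"
    and "e \<in> nsets V r \<Longrightarrow> coverage r (link r v L) e = coverage (Suc r) L (insert v e)"
proof -
  have L: "(LEAST k. v \<in> A k) < Suc r" "v \<in> A (LEAST k. v \<in> A k)"
    if "\<exists>k<Suc r. v \<in> A k" for A :: "nat \<Rightarrow> 'a set"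
    using that by (meson LeastI Least_le le_less_trans)+
  show "\<forall>B\<in>set (link r v L). parts_in r V B"
  proof
    fix B assume "B \<in> set (link r v L)"
    then obtain A where A: "A \<in> set L" "\<exists>k<Suc r. v \<in> A k"
      "B = (\<lambda>i. A (if i < (LEAST k. v \<in> A k) then i else Suc i))" by (auto simp: link_def)
    have "parts_in (Suc r) (insert v V) A" using A(1) assms(1) by blast
    from link_member(1)[OF this L[OF A(2)]] show "parts_in r V B" by (simp only: A(3))
  qed
  assume e: "e \<in> nsets V r"
  \<comment> \<open>Otherwise \<open>e\<close>, with only \<open>r\<close> points, would itself meet
    \<open>Suc r\<close> disjoint parts.\<close>
  have none: "\<not> rainbow (Suc r) A (insert v e)"
    if A: "parts_in (Suc r) (insert v V) A" and no: "\<not> (\<exists>k<Suc r. v \<in> A k)" for A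
  proof
    assume "rainbow (Suc r) A (insert v e)"
    then have "rainbow (Suc r) A e" using no by (auto simp: rainbow_def)
    then show False using rainbow_card_le[OF A, of e] e by (auto simp: nsets_def)
  qed
  show "coverage r (link r v L) e = coverage (Suc r) L (insert v e)"
    using assms(1)
  proof (induction L)
    case Nil
    show ?case by (simp add: link_def)
  next
    case (Cons A L)
    then have A: "parts_in (Suc r) (insert v V) A" and
      IH: "coverage r (link r v L) e = coverage (Suc r) L (insert v e)" by auto
    show ?case
    proof (cases "\<exists>k<Suc r. v \<in> A k")
      case True
      have "rainbow (Suc r) A (insert v e) \<longleftrightarrow>
        rainbow r (\<lambda>i. A (if i < (LEAST k. v \<in> A k) then i else Suc i)) e"
        using e assms(2) by (intro link_member(2)[OF A L[OF True]]) (auto simp: nsets_def)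
      then show ?thesis using True IH by (simp add: link_def)
    next
      case False
      then have "link r v (A # L) = link r v L" by (simp add: link_def)
      then show ?thesis using none[OF A False] IH by simp
    qed
  qed
qed

section \<open>Upper bounds for odd covers\<close>

text \<open>The bound is monotone in \<open>k\<close>, and arbitrary vertex types allow products and
  halves of a vertex set.\<close>

definition odd_coverable :: "nat \<Rightarrow> 'a set \<Rightarrow> nat \<Rightarrow> bool" where
  "odd_coverable r V k \<longleftrightarrow> (\<exists>L. length L \<le> k \<and> (\<forall>A\<in>set L. parts_in r V A) \<and>
     (\<forall>e\<in>nsets V r. odd (coverage r L e)))"

text \<open>A family may list the same hypergraph several times; the hypergraphs of odd multiplicity
  form an odd cover.\<close>

lemma exists_set_of_odd_multiplicity:
  assumes "\<forall>A\<in>set L. parts_in r V A"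
  shows "\<exists>C. finite C \<and> card C \<le> length L \<and> (\<forall>H\<in>C. is_complete_partite r V H) \<and>
    (\<forall>e\<in>nsets V r. odd (card {H \<in> C. e \<in> H}) \<longleftrightarrow> odd (coverage r L e))"
  using assms
proof (induction L)
  case Nil
  show ?case by (intro exI[of _ "{}"]) simp
next
  case (Cons A L)
  then obtain C where C: "finite C" "card C \<le> length L" "\<forall>H\<in>C. is_complete_partite r V H"
    "\<And>e. e \<in> nsets V r \<Longrightarrow> odd (card {H \<in> C. e \<in> H}) \<longleftrightarrow> odd (coverage r L e)" by auto
  define G where "G = complete_partite r V A"
  have G: "is_complete_partite r V G" using Cons.prems by (auto simp: is_complete_partite_iff G_def)
  have mem: "e \<in> G \<longleftrightarrow> rainbow r A e" if "e \<in> nsets V r" for e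
    using that by (simp add: G_def mem_complete_partite)
  show ?case
  \<comment> \<open>Modulo 2, adding a hypergraph that is already present amounts to deleting
    it.\<close>
  proof (cases "G \<in> C")
    case True
    have "odd (card {H \<in> C - {G}. e \<in> H}) \<longleftrightarrow> odd (coverage r (A # L) e)" if e: "e \<in> nsets V r" for e
    proof (cases "e \<in> G")
      case eG: True
      have "{H \<in> C. e \<in> H} = insert G {H \<in> C - {G}. e \<in> H}" using True eG by auto
      then have "card {H \<in> C. e \<in> H} = Suc (card {H \<in> C - {G}. e \<in> H})" using C(1) by simp
      then show ?thesis using C(4)[OF e] mem[OF e] eG by auto
    next
      case False
      then have "{H \<in> C - {G}. e \<in> H} = {H \<in> C. e \<in> H}" by auto
      then show ?thesis using C(4)[OF e] mem[OF e] False by auto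
    qed
    moreover have "card (C - {G}) \<le> length (A # L)" using C(1,2) True by (simp add: card_Diff_singleton)
    ultimately show ?thesis using C by (intro exI[of _ "C - {G}"]) auto
  next
    case False
    have "odd (card {H \<in> insert G C. e \<in> H}) \<longleftrightarrow> odd (coverage r (A # L) e)" if e: "e \<in> nsets V r" for e
    proof (cases "e \<in> G")
      case eG: True
      have "{H \<in> insert G C. e \<in> H} = insert G {H \<in> C. e \<in> H}" using eG by auto
      then have "card {H \<in> insert G C. e \<in> H} = Suc (card {H \<in> C. e \<in> H})" using C(1) False by simp
      then show ?thesis using C(4)[OF e] mem[OF e] eG by auto
    next
      case eG: False
      then have "{H \<in> insert G C. e \<in> H} = {H \<in> C. e \<in> H}" by auto
      then show ?thesis using C(4)[OF e] mem[OF e] eG by auto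
    qed
    then show ?thesis using C G False by (intro exI[of _ "insert G C"]) auto
  qed
qed

lemma odd_cover_number_le:
  assumes "odd_coverable r {..<n} k"
  shows "odd_cover_number r n \<le> k"
proof -
  obtain L where L: "length L \<le> k" "\<forall>A\<in>set L. parts_in r {..<n} A"
    "\<forall>e\<in>nsets {..<n} r. odd (coverage r L e)" using assms by (auto simp: odd_coverable_def)
  then obtain C where C: "finite C" "card C \<le> length L" "\<forall>H\<in>C. is_complete_partite r {..<n} H"
    "\<forall>e\<in>nsets {..<n} r. odd (card {H \<in> C. e \<in> H}) \<longleftrightarrow> odd (coverage r L e)"
    using exists_set_of_odd_multiplicity[OF L(2)] by blast
  have "odd_cover r {..<n} C" using C L by (simp add: odd_cover_def)
  then have "odd_cover_number r n \<le> card C" unfolding odd_cover_number_def by (intro Least_le) blast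
  then show ?thesis using C L by linarith
qed

text \<open>Pull the parts back along \<open>f\<close>: an edge is rainbow for the preimages exactly
  when its image, again an \<open>r\<close>-set, is rainbow.\<close>

lemma odd_coverable_transport:
  assumes f: "inj_on f V" "f ` V \<subseteq> W" and cov: "odd_coverable r W k"
  shows "odd_coverable r V k"
proof -
  obtain L where L: "length L \<le> k" "\<forall>A\<in>set L. parts_in r W A"
    "\<forall>e\<in>nsets W r. odd (coverage r L e)" using cov by (auto simp: odd_coverable_def)
  define M where "M = map (\<lambda>A i. {v \<in> V. f v \<in> A i}) L"
  have "\<forall>B\<in>set M. parts_in r V B"
    using L(2) unfolding M_def parts_in_def disjoint_family_on_def by fastforce
  moreover have "odd (coverage r M e)" if e: "e \<in> nsets V r" for e
  proof -
    have "rainbow r (\<lambda>i. {v \<in> V. f v \<in> A i}) e \<longleftrightarrow> rainbow r A (f ` e)" for A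
      using e unfolding rainbow_def nsets_def by fastforce
    then have "coverage r M e = coverage r L (f ` e)" by (simp add: coverage_def M_def o_def)
    moreover have "f ` e \<in> nsets W r"
      using e f by (auto simp: nsets_def card_image inj_on_subset)
    ultimately show ?thesis using L(3) by simp
  qed
  ultimately show ?thesis using L(1) unfolding odd_coverable_def by (intro exI[of _ M]) (auto simp: M_def)
qed

lemma odd_coverable_finite:
  assumes "finite V" "card V \<le> card W" "finite W" "odd_coverable r W k"
  shows "odd_coverable r V k"
proof -
  obtain f where "f ` V \<subseteq> W" "inj_on f V" using card_le_inj[OF assms(1,3,2)] by blast
  then show ?thesis using odd_coverable_transport assms(4) by blast
qed

section \<open>Trivial cases of odd covers\<close>

text \<open>The only edge is the empty set, vacuously rainbow for any choice of parts.\<close>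

lemma odd_coverable_0: "odd_coverable 0 V 1"
  unfolding odd_coverable_def
  by (intro exI[of _ "[\<lambda>_. {}]"]) (auto simp: parts_in_def rainbow_def disjoint_family_on_def)

lemma odd_coverable_1: "odd_coverable 1 V 1"
  unfolding odd_coverable_def
  by (intro exI[of _ "[\<lambda>_. V]"])
     (auto simp: parts_in_def rainbow_def disjoint_family_on_def nsets_one)

lemma odd_coverable_small: "finite V \<Longrightarrow> card V < r \<Longrightarrow> odd_coverable r V 0"
  unfolding odd_coverable_def by (simp add: nsets_eq_empty)

subsection \<open>Three parts\<close>

lemma odd_coverable_3_pairs: "odd_coverable 3 ({..<m} \<times> (UNIV :: bool set)) m"
proof -
  define c where "c i j b = (if j = i then 0 else if b = (j < i) then 1 else 2 :: nat)"
    for i j :: nat and b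
  define A :: "nat \<Rightarrow> nat \<Rightarrow> (nat \<times> bool) set" where
    "A i k = {(j, b). j < m \<and> c i j b = k}" for i k
  have parts: "parts_in 3 ({..<m} \<times> UNIV) (A i)" for i
    by (auto simp: parts_in_def disjoint_family_on_def A_def)
  have all3: "(\<forall>k<3. P k) \<longleftrightarrow> P 0 \<and> P 1 \<and> P (2::nat)" for P
    by (auto simp: numeral_3_eq_3 numeral_2_eq_2 less_Suc_eq)
  have "odd (coverage 3 (map A [0..<m]) e)" if e: "e \<in> nsets ({..<m} \<times> UNIV) 3" for e
  proof -
    obtain x y z where xyz: "e = {x, y, z}" "x \<noteq> y" "x \<noteq> z" "y \<noteq> z" "fst x \<le> fst y" "fst y \<le> fst z"
    proof -
      obtain a b c where abc: "e = {a, b, c}" "a \<noteq> b" "a \<noteq> c" "b \<noteq> c"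
        using e unfolding nsets_def card_3_iff by blast
      consider "fst a \<le> fst b \<and> fst b \<le> fst c" | "fst a \<le> fst c \<and> fst c \<le> fst b"
        | "fst b \<le> fst a \<and> fst a \<le> fst c" | "fst b \<le> fst c \<and> fst c \<le> fst a"
        | "fst c \<le> fst a \<and> fst a \<le> fst b" | "fst c \<le> fst b \<and> fst b \<le> fst a" by linarith
      then show thesis
      proof cases
        case 1 then show ?thesis using that[of a b c] abc by auto
      next
        case 2 then show ?thesis using that[of a c b] abc by auto
      next
        case 3 then show ?thesis using that[of b a c] abc by auto
      next
        case 4 then show ?thesis using that[of b c a] abc by auto
      next
        case 5 then show ?thesis using that[of c a b] abc by auto
      next
        case 6 then show ?thesis using that[of c b a] abc by auto
      qed
    qed
    obtain p u q v r w where pqr: "x = (p, u)" "y = (q, v)" "z = (r, w)" by (metis surj_pair)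
    have lt: "p < m" "q < m" "r < m" and le: "p \<le> q" "q \<le> r"
      using e xyz pqr by (auto simp: nsets_def)
    \<comment> \<open>Colour 0 occurs only on the pair with index \<open>i\<close>, so only
      \<open>i\<close> among \<open>p\<close>, \<open>q\<close>, \<open>r\<close> can make the
      triple rainbow.\<close>
    have rb: "rainbow 3 (A i) e \<longleftrightarrow> (\<forall>k<3. c i p u = k \<or> c i q v = k \<or> c i r w = k)" for i
      using lt by (auto simp: rainbow_def xyz(1) pqr A_def)
    have "coverage 3 (map A [0..<m]) e = (\<Sum>i<m. of_bool (rainbow 3 (A i) e))"
      by (simp add: coverage_def o_def interv_sum_list_conv_sum_set_nat atLeast0LessThan)
    also have "\<dots> = card {i. i < m \<and> rainbow 3 (A i) e}"
      by (simp add: Int_def)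
    also have "odd \<dots>"
    proof -
      consider "p = q" "q < r" "u \<noteq> v" | "p < q" "q = r" "v \<noteq> w" | "p < q" "q < r"
        using le xyz(2-4) pqr by fastforce
      then show ?thesis
      proof cases
        case 1
        then have "rainbow 3 (A i) e \<longleftrightarrow> i = r" for i
          unfolding rb all3 c_def by auto
        then have "{i. i < m \<and> rainbow 3 (A i) e} = {r}" using lt by auto
        then show ?thesis by simp
      next
        case 2
        then have "rainbow 3 (A i) e \<longleftrightarrow> i = p" for i
          unfolding rb all3 c_def by auto
        then have "{i. i < m \<and> rainbow 3 (A i) e} = {p}" using lt by auto
        then show ?thesis by simp
      next
        case 3
        \<comment> \<open>At \<open>i = q\<close> one of the other two indices is below
          \<open>i\<close> and one above, so equal bits get different colours. Among
          \<open>v \<noteq> w\<close>, \<open>u \<noteq> w\<close>, \<open>u \<noteq> v\<close> an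
          even number hold; negating the middle one makes the count odd.\<close>
        then have "rainbow 3 (A i) e \<longleftrightarrow> i = p \<and> v \<noteq> w \<or> i = q \<and> u = w \<or> i = r \<and> u \<noteq> v" for i
          unfolding rb all3 c_def by auto
        then have "{i. i < m \<and> rainbow 3 (A i) e} =
            (if v \<noteq> w then {p} else {}) \<union> (if u = w then {q} else {}) \<union> (if u \<noteq> v then {r} else {})"
          using lt by auto
        then show ?thesis using 3 by (cases u; cases v; cases w) auto
      qed
    qed
    finally show ?thesis .
  qed
  then show ?thesis
    unfolding odd_coverable_def using parts by (intro exI[of _ "map A [0..<m]"]) auto
qed

lemma odd_coverable_3:
  assumes "finite V"
  shows "odd_coverable 3 V ((card V + 1) div 2)"
  by (rule odd_coverable_finite[OF assms _ _ odd_coverable_3_pairs]) (auto simp: card_cartesian_product)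

lemma odd_coverable_link:
  assumes "odd_coverable (Suc r) (insert v V) k" "v \<notin> V"
  shows "odd_coverable r V k"
proof -
  obtain L where L: "length L \<le> k" "\<forall>A\<in>set L. parts_in (Suc r) (insert v V) A"
    "\<forall>e\<in>nsets (insert v V) (Suc r). odd (coverage (Suc r) L e)"
    using assms by (auto simp: odd_coverable_def)
  have "length (link r v L) \<le> k" using L(1) length_filter_le order_trans
    unfolding link_def length_map by blast
  moreover have "odd (coverage r (link r v L) e)" if e: "e \<in> nsets V r" for e
  proof -
    have "insert v e \<in> nsets (insert v V) (Suc r)" using e assms(2) by (auto simp: nsets_def card_insert_if)
    then show ?thesis using link_family(2)[OF L(2) assms(2) e] L(3) by simp
  qed
  ultimately show ?thesis
    unfolding odd_coverable_def using link_family(1)[OF L(2) assms(2)] by blast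
qed

text \<open>Add one vertex, cover the triples, and take the link of the added vertex.\<close>

lemma odd_coverable_2:
  assumes "finite V"
  shows "odd_coverable 2 V ((card V + 2) div 2)"
proof -
  let ?n = "card V"
  have "odd_coverable 3 (insert ?n {..<?n}) ((?n + 2) div 2)"
    using odd_coverable_3[of "insert ?n {..<?n}"] by simp
  then have "odd_coverable 2 {..<?n} ((?n + 2) div 2)"
    using odd_coverable_link[of 2 ?n "{..<?n}"] by (simp add: numeral_3_eq_3 numeral_2_eq_2)
  then show ?thesis using odd_coverable_finite[OF assms, of "{..<?n}"] by simp
qed

subsection \<open>Four parts\<close>

definition join :: "nat \<Rightarrow> (nat \<Rightarrow> 'a set) \<Rightarrow> (nat \<Rightarrow> 'a set) \<Rightarrow> nat \<Rightarrow> 'a set" where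
  "join p A B i = (if i < p then A i else B (i - p))"

lemma parts_in_join:
  assumes A: "parts_in p U A" and B: "parts_in q W B" and UW: "U \<inter> W = {}"
  shows "parts_in (p + q) (U \<union> W) (join p A B)"
    and "e \<subseteq> U \<union> W \<Longrightarrow> rainbow (p + q) (join p A B) e \<longleftrightarrow> rainbow p A (e \<inter> U) \<and> rainbow q B (e \<inter> W)"
proof -
  have sub: "join p A B i \<subseteq> (if i < p then U else W)" if "i < p + q" for i
    using A B that by (auto simp: join_def parts_in_def)
  have "join p A B i \<inter> join p A B j = {}" if ij: "i < p + q" "j < p + q" "i \<noteq> j" for i j
  proof (cases "i < p \<longleftrightarrow> j < p")
    case True
    then show ?thesis
      using A B ij unfolding parts_in_def disjoint_family_on_def join_def
      by (cases "i < p") (auto simp: less_diff_conv2 eq_diff_iff)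
  next
    case False
    then show ?thesis using sub[OF ij(1)] sub[OF ij(2)] UW by (auto split: if_splits)
  qed
  then show "parts_in (p + q) (U \<union> W) (join p A B)"
    using sub unfolding parts_in_def disjoint_family_on_def by (fastforce split: if_splits)
  assume e: "e \<subseteq> U \<union> W"
  have A1: "e \<inter> U \<inter> A i = e \<inter> A i" if "i < p" for i using A that by (auto simp: parts_in_def)
  have B1: "e \<inter> W \<inter> B i = e \<inter> B i" if "i < q" for i using B that by (auto simp: parts_in_def)
  have "(\<forall>i<p+q. e \<inter> join p A B i \<noteq> {}) \<longleftrightarrow>
    (\<forall>i<p. e \<inter> A i \<noteq> {}) \<and> (\<forall>i<q. e \<inter> B i \<noteq> {})" (is "?l \<longleftrightarrow> ?r")
  proof
    assume l: ?l
    have "e \<inter> A i \<noteq> {}" if "i < p" for i using l[rule_format, of i] that by (simp add: join_def)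
    moreover have "e \<inter> B i \<noteq> {}" if "i < q" for i
      using l[rule_format, of "i + p"] that by (simp add: join_def)
    ultimately show ?r by blast
  next
    assume ?r
    then show ?l by (auto simp: join_def less_diff_conv2)
  qed
  then show "rainbow (p + q) (join p A B) e \<longleftrightarrow> rainbow p A (e \<inter> U) \<and> rainbow q B (e \<inter> W)"
    by (simp add: rainbow_def A1 B1)
qed

definition join_all ::
  "nat \<Rightarrow> (nat \<Rightarrow> 'a set) list \<Rightarrow> (nat \<Rightarrow> 'a set) list \<Rightarrow> (nat \<Rightarrow> 'a set) list" where
  "join_all p L M = concat (map (\<lambda>A. map (join p A) M) L)"

lemma length_join_all: "length (join_all p L M) = length L * length M"
  by (induction L) (auto simp: join_all_def)

text \<open>A joined member covers \<open>e\<close> exactly when its two constituents cover the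
  traces of \<open>e\<close> on \<open>U\<close> and on \<open>W\<close>, so the counts
  multiply.\<close>

lemma coverage_join_all:
  assumes "\<forall>A\<in>set L. parts_in p U A" "\<forall>B\<in>set M. parts_in q W B" "U \<inter> W = {}" "e \<subseteq> U \<union> W"
  shows "coverage (p + q) (join_all p L M) e = coverage p L (e \<inter> U) * coverage q M (e \<inter> W)"
proof -
  have row: "coverage (p + q) (map (join p A) M) e = of_bool (rainbow p A (e \<inter> U)) * coverage q M (e \<inter> W)"
    if "parts_in p U A" for A
    using assms(2) by (induction M) (auto simp: parts_in_join(2)[OF that _ assms(3,4)])
  show ?thesis
    using assms(1) by (induction L) (auto simp: join_all_def row distrib_right)
qed

lemma coverage_eq_0:
  assumes "\<forall>A\<in>set L. parts_in r V A" "finite e" "card e < r"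
  shows "coverage r L e = 0"
proof -
  have "\<not> rainbow r A e" if "A \<in> set L" for A
    using that assms rainbow_card_le by (metis not_le)
  then show ?thesis by (simp add: coverage_def)
qed

text \<open>Joining families for \<open>U\<close> and \<open>W\<close> with \<open>p\<close> and \<open>r - p\<close> parts covers exactly the edges
  with \<open>p\<close> vertices in \<open>U\<close>, up to even multiplicities.\<close>

lemma odd_coverable_Un:
  assumes fin: "finite U" "finite W" and UW: "U \<inter> W = {}"
    and c: "\<And>p. p \<le> r \<Longrightarrow> odd_coverable p U (c p)"
    and d: "\<And>p. p \<le> r \<Longrightarrow> odd_coverable p W (d p)"
  shows "odd_coverable r (U \<union> W) (\<Sum>p\<le>r. c p * d (r - p))"
proof -
  have "\<forall>p. \<exists>L. p \<le> r \<longrightarrow> length L \<le> c p \<and> (\<forall>A\<in>set L. parts_in p U A) \<and>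
      (\<forall>e\<in>nsets U p. odd (coverage p L e))" using c unfolding odd_coverable_def by blast
  then obtain L where L: "\<And>p. p \<le> r \<Longrightarrow> length (L p) \<le> c p"
    "\<And>p. p \<le> r \<Longrightarrow> \<forall>A\<in>set (L p). parts_in p U A"
    "\<And>p e. p \<le> r \<Longrightarrow> e \<in> nsets U p \<Longrightarrow> odd (coverage p (L p) e)" by metis
  have "\<forall>p. \<exists>L. p \<le> r \<longrightarrow> length L \<le> d p \<and> (\<forall>A\<in>set L. parts_in p W A) \<and>
      (\<forall>e\<in>nsets W p. odd (coverage p L e))" using d unfolding odd_coverable_def by blast
  then obtain M where M: "\<And>p. p \<le> r \<Longrightarrow> length (M p) \<le> d p"
    "\<And>p. p \<le> r \<Longrightarrow> \<forall>A\<in>set (M p). parts_in p W A"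
    "\<And>p e. p \<le> r \<Longrightarrow> e \<in> nsets W p \<Longrightarrow> odd (coverage p (M p) e)" by metis
  define N where "N = concat (map (\<lambda>p. join_all p (L p) (M (r - p))) [0..<Suc r])"
  have sum_upt: "(\<Sum>p\<leftarrow>[0..<Suc r]. f p) = (\<Sum>p\<le>r. f p)" for f :: "nat \<Rightarrow> nat"
    by (simp only: interv_sum_list_conv_sum_set_nat set_upt atLeast0LessThan lessThan_Suc_atMost)
  have "length N = (\<Sum>p\<le>r. length (L p) * length (M (r - p)))"
    unfolding N_def length_concat map_map o_def length_join_all sum_upt ..
  also have "\<dots> \<le> (\<Sum>p\<le>r. c p * d (r - p))"
    by (intro sum_mono mult_le_mono L(1) M(1)) auto
  finally have len: "length N \<le> (\<Sum>p\<le>r. c p * d (r - p))" .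
  have parts: "\<forall>A\<in>set N. parts_in r (U \<union> W) A"
  proof
    fix A assume "A \<in> set N"
    then obtain p B B' where p: "p \<le> r" "B \<in> set (L p)" "B' \<in> set (M (r - p))" "A = join p B B'"
      unfolding N_def join_all_def set_concat set_map set_upt by (auto simp: image_iff less_Suc_eq_le simp del: upt_Suc)
    then have "parts_in p U B" "parts_in (r - p) W B'" using L(2)[of p] M(2)[of "r - p"] by auto
    then have "parts_in (p + (r - p)) (U \<union> W) A"
      unfolding p(4) by (rule parts_in_join(1)[OF _ _ UW])
    then show "parts_in r (U \<union> W) A" using p(1) by simp
  qed
  have "odd (coverage r N e)" if e: "e \<in> nsets (U \<union> W) r" for e
  proof -
    define s where "s = card (e \<inter> U)"
    have ef: "finite e" "e \<subseteq> U \<union> W" "card e = r" using e by (auto simp: nsets_def)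
    have "e = (e \<inter> U) \<union> (e \<inter> W)" "e \<inter> U \<inter> (e \<inter> W) = {}" using ef UW by auto
    then have sr: "s + card (e \<inter> W) = r"
      unfolding s_def using card_Un_disjoint[of "e \<inter> U" "e \<inter> W"] ef by (metis finite_Int)
    have term_eq: "coverage r (join_all p (L p) (M (r - p))) e =
        coverage p (L p) (e \<inter> U) * coverage (r - p) (M (r - p)) (e \<inter> W)" if "p \<le> r" for p
      using coverage_join_all[OF L(2)[OF that] M(2)[of "r - p"] UW ef(2)] that by simp
    \<comment> \<open>If \<open>p > s\<close>, the trace on \<open>U\<close> has too few points for
      \<open>p\<close> parts; if \<open>p < s\<close>, the trace on \<open>W\<close> has too few for
      \<open>r - p\<close>.\<close>
    have zero: "coverage r (join_all p (L p) (M (r - p))) e = 0" if p: "p \<le> r" "p \<noteq> s" for p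
    proof (cases "s < p")
      case True
      then show ?thesis using coverage_eq_0[OF L(2)[OF p(1)], of "e \<inter> U"] ef term_eq[OF p(1)]
        by (simp add: s_def)
    next
      case False
      then show ?thesis using coverage_eq_0[OF M(2)[of "r - p"], of "e \<inter> W"] ef term_eq[OF p(1)] sr p
        by simp
    qed
    have "coverage r N e = (\<Sum>p\<le>r. coverage r (join_all p (L p) (M (r - p))) e)"
      unfolding N_def coverage_concat map_map o_def sum_upt ..
    also have "\<dots> = (\<Sum>p\<in>{s}. coverage r (join_all p (L p) (M (r - p))) e)"
      using sr zero by (intro sum.mono_neutral_right) auto
    also have "\<dots> = coverage s (L s) (e \<inter> U) * coverage (r - s) (M (r - s)) (e \<inter> W)"
      using term_eq[of s] sr by simp
    also have "odd \<dots>"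
      using L(3)[of s "e \<inter> U"] M(3)[of "r - s" "e \<inter> W"] sr ef by (auto simp: nsets_def s_def)
    finally show ?thesis .
  qed
  then show ?thesis unfolding odd_coverable_def using len parts by blast
qed

text \<open>The linear part \<open>31 n - 30\<close> makes the bound positive from
  \<open>n = 1\<close> on, while leaving enough slack for the induction over halves.\<close>

lemma odd_coverable_4:
  assumes "finite V" "V \<noteq> {}"
  shows "\<exists>t. odd_coverable 4 V t \<and> real t \<le> (real (card V))\<^sup>2 / 7 + 31 * real (card V) - 30"
  using assms
proof (induction "card V" arbitrary: V rule: less_induct)
  case less
  show ?case
  proof (cases "card V < 4")
    case True
    have "card V \<ge> 1" using less.prems by (simp add: Suc_leI card_gt_0_iff)
    then show ?thesis using odd_coverable_small[OF less.prems(1) True] by (intro exI[of _ 0]) (auto intro: add_increasing)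
  next
    case False
    obtain U where U: "U \<subseteq> V" "card U = card V div 2"
      using obtain_subset_with_card_n[of "card V div 2" V] by auto
    define W where "W = V - U"
    define a b where "a = card U" and "b = card W"
    have fin: "finite U" "finite W" "U \<inter> W = {}" "V = U \<union> W"
      using U less.prems(1) by (auto simp: W_def finite_subset)
    have b: "b = card V - card V div 2"
      unfolding b_def W_def using U fin by (simp add: card_Diff_subset)
    have ab: "a + b = card V" "b = a \<or> b = Suc a" "a < card V" "b < card V" "U \<noteq> {}" "W \<noteq> {}"
      using b U False unfolding a_def by (auto simp: b_def)
    obtain s where s: "odd_coverable 4 U s" "real s \<le> (real a)\<^sup>2 / 7 + 31 * real a - 30"
      using less.hyps[of U] ab fin by (auto simp: a_def)
    obtain t where t: "odd_coverable 4 W t" "real t \<le> (real b)\<^sup>2 / 7 + 31 * real b - 30"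
      using less.hyps[of W] ab fin by (auto simp: b_def)
    have four: "p = 0 \<or> p = 1 \<or> p = 2 \<or> p = 3 \<or> p = 4" if "p \<le> 4" for p :: nat
      using that by linarith
    \<comment> \<open>Sizes of the available covers of an \<open>n\<close>-set with 0, 1, 2, 3 and 4
      parts, the last one being the inductive bound \<open>s\<close>.\<close>
    define c where "c n s = ((!) [1, 1, (n + 2) div 2, (n + 1) div 2, s])" for n s :: nat
    have "odd_coverable p U (c a s p)" if "p \<le> 4" for p
      using four[OF that] s(1) odd_coverable_0 odd_coverable_1 odd_coverable_2[OF fin(1)]
        odd_coverable_3[OF fin(1)] by (auto simp: c_def a_def)
    moreover have "odd_coverable p W (c b t p)" if "p \<le> 4" for p
      using four[OF that] t(1) odd_coverable_0 odd_coverable_1 odd_coverable_2[OF fin(2)]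
        odd_coverable_3[OF fin(2)] by (auto simp: c_def b_def)
    ultimately have cov: "odd_coverable 4 V (\<Sum>p\<le>4. c a s p * c b t (4 - p))"
      using odd_coverable_Un[OF fin(1-3), of 4 "c a s" "c b t"] fin(4) by simp
    have "(\<Sum>p\<le>4. c a s p * c b t (4 - p)) =
        s + t + (a + 1) div 2 + (b + 1) div 2 + ((a + 2) div 2) * ((b + 2) div 2)"
      by (simp add: c_def numeral_eq_Suc algebra_simps)
    then have "real (\<Sum>p\<le>4. c a s p * c b t (4 - p)) =
        real s + real t + real ((a + 1) div 2) + real ((b + 1) div 2) +
        real ((a + 2) div 2) * real ((b + 2) div 2)"
      by (simp only: of_nat_add of_nat_mult)
    also have "\<dots> \<le> ((real a)\<^sup>2 / 7 + 31 * real a - 30) + ((real b)\<^sup>2 / 7 + 31 * real b - 30) +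
        (real a + 1) / 2 + (real b + 1) / 2 + (real a + 2) / 2 * ((real b + 2) / 2)"
      by (intro add_mono mult_mono s(2) t(2)) auto
    also have "\<dots> \<le> (real a + real b)\<^sup>2 / 7 + 31 * (real a + real b) - 30"
    proof -
      \<comment> \<open>The right side minus the left side is exactly
        \<open>(a - 28)(b - 28) / 28\<close>. The integers \<open>a\<close> and \<open>b\<close>
        differ by at most one, so they never lie strictly on opposite sides of 28.\<close>
      have "0 \<le> (real a - 28) * (real b - 28)"
      proof (cases "a \<ge> 28")
        case True
        then show ?thesis using ab(2) by auto
      next
        case False
        then show ?thesis using ab(2) by (intro mult_nonpos_nonpos) auto
      qed
      then show ?thesis by (simp add: field_simps power2_eq_square)
    qed
    also have "real a + real b = real (card V)" using ab(1) by (metis of_nat_add)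
    finally show ?thesis using cov by blast
  qed
qed

section \<open>Lower bounds for partitions\<close>

subsection \<open>Underdetermined linear systems\<close>

text \<open>Gaussian elimination, with one equation and one unknown removed at each induction
  step.\<close>

lemma exists_nonzero_solution:
  fixes cs :: "('b \<Rightarrow> real) list"
  assumes "finite P" "length cs < card P"
  shows "\<exists>y. (\<exists>p\<in>P. y p \<noteq> 0) \<and> (\<forall>c\<in>set cs. (\<Sum>p\<in>P. c p * y p) = 0)"
  using assms
proof (induction "length cs" arbitrary: cs P)
  case 0
  then have "P \<noteq> {}" by auto
  then show ?case using 0 by (intro exI[of _ "\<lambda>_. 1"]) auto
next
  case (Suc n)
  then obtain c ds where cs: "cs = c # ds" "length ds = n" by (metis length_Suc_conv)
  show ?case
  proof (cases "\<forall>p\<in>P. c p = 0")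
    case True
    obtain y where "\<exists>p\<in>P. y p \<noteq> 0" "\<forall>c\<in>set ds. (\<Sum>p\<in>P. c p * y p) = 0"
      using Suc.hyps(1)[of ds P] Suc.prems cs by auto
    then show ?thesis using True cs by (intro exI[of _ y]) auto
  next
    case False
    then obtain s where s: "s \<in> P" "c s \<noteq> 0" by blast
    \<comment> \<open>Use \<open>c\<close> with pivot \<open>s\<close> to eliminate the unknown at
      \<open>s\<close> from the remaining equations; the value of \<open>y s\<close> below then
      solves \<open>c\<close> itself.\<close>
    define es where "es = map (\<lambda>d p. d p - d s / c s * c p) ds"
    have "n = length es" "finite (P - {s})" "length es < card (P - {s})"
      using Suc.prems cs s(1) by (auto simp: es_def)
    from Suc.hyps(1)[OF this] obtain z where
      z: "\<exists>p\<in>P - {s}. z p \<noteq> 0" "\<forall>e\<in>set es. (\<Sum>p\<in>P - {s}. e p * z p) = 0" by blast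
    define y where "y = z(s := - (\<Sum>p\<in>P - {s}. c p * z p) / c s)"
    have split: "(\<Sum>p\<in>P. d p * y p) = d s * y s + (\<Sum>p\<in>P - {s}. d p * z p)" for d
      using sum.remove[OF Suc.prems(1) s(1), of "\<lambda>p. d p * y p"] by (simp add: y_def)
    have "(\<Sum>p\<in>P. d p * y p) = 0" if "d \<in> set ds" for d
    proof -
      have "0 = (\<Sum>p\<in>P - {s}. (d p - d s / c s * c p) * z p)"
        using z(2) that by (auto simp: es_def)
      also have "\<dots> = (\<Sum>p\<in>P - {s}. d p * z p) - d s / c s * (\<Sum>p\<in>P - {s}. c p * z p)"
        by (simp add: left_diff_distrib sum_subtractf sum_distrib_left mult.assoc)
      finally show ?thesis unfolding split by (simp add: y_def)
    qed
    moreover have "(\<Sum>p\<in>P. c p * y p) = 0" unfolding split using s by (simp add: y_def)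
    moreover have "\<exists>p\<in>P. y p \<noteq> 0" using z(1) by (auto simp: y_def)
    ultimately show ?thesis using cs by (intro exI[of _ y]) auto
  qed
qed

subsection \<open>The disjointness form\<close>

definition meets :: "(nat \<Rightarrow> 'a set) \<Rightarrow> nat set \<Rightarrow> 'a set \<Rightarrow> real" where
  "meets A S p = of_bool (\<forall>i\<in>S. p \<inter> A i \<noteq> {})"

text \<open>Sorting the parts met by \<open>p\<close> from those met by \<open>q\<close> writes the matrix of a complete
  partite graph, indexed by pairs of \<open>k\<close>-sets, as a sum of matrices of rank one.\<close>

lemma rainbow_Un_eq_sum:
  assumes A: "parts_in (2 * k) V A" and p: "p \<in> nsets V k" and q: "q \<in> nsets V k"
  shows "of_bool (p \<inter> q = {} \<and> rainbow (2 * k) A (p \<union> q)) =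
    (\<Sum>S\<in>nsets {..<2 * k} k. meets A S p * meets A ({..<2 * k} - S) q)"
proof -
  define S0 where "S0 = {i. i < 2 * k \<and> p \<inter> A i \<noteq> {}}"
  have disj: "disjoint_family_on A I" if "I \<subseteq> {..<2 * k}" for I
    using A disjoint_family_on_mono[OF that] by (auto simp: parts_in_def)
  have pq: "finite p" "finite q" "card p = k" "card q = k" using p q by (auto simp: nsets_def)
  \<comment> \<open>In a nonzero term the \<open>k\<close> points of \<open>p\<close> are used up by
    the \<open>k\<close> disjoint parts in \<open>S\<close>, so \<open>p\<close> meets no other part
    and \<open>S = S0\<close>. Conversely, \<open>p\<close> and \<open>q\<close> meet at most
    \<open>k\<close> parts each, and rainbowness forces \<open>S0\<close> to have size
    \<open>k\<close>.\<close>
  have key: "S \<in> nsets {..<2 * k} k \<and> (\<forall>i\<in>S. p \<inter> A i \<noteq> {}) \<and> (\<forall>i\<in>{..<2 * k} - S. q \<inter> A i \<noteq> {})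
     \<longleftrightarrow> p \<inter> q = {} \<and> rainbow (2 * k) A (p \<union> q) \<and> S = S0" (is "?l \<longleftrightarrow> ?r") for S
  proof
    assume l: ?l
    then have S: "S \<subseteq> {..<2 * k}" "finite S" "card S = k" by (auto simp: nsets_def)
    then have card': "card ({..<2 * k} - S) = k" by (simp add: card_Diff_subset)
    have psub: "p \<subseteq> (\<Union>i\<in>S. A i)"
      using disjoint_family_on_inter_card(3)[OF disj[OF S(1)] pq(1)] l S pq by auto
    have qsub: "q \<subseteq> (\<Union>i\<in>{..<2 * k} - S. A i)"
      using disjoint_family_on_inter_card(3)[OF disj pq(2), of "{..<2 * k} - S"] l card' pq by auto
    have AA: "A i \<inter> A j = {}" if "i \<in> S" "j \<in> {..<2 * k} - S" for i j
    proof -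
      have "i \<in> {..<2 * k}" "j \<in> {..<2 * k}" "i \<noteq> j" using that S(1) by auto
      with disj[of "{..<2 * k}"] show ?thesis by (auto simp: disjoint_family_on_def)
    qed
    have "p \<inter> q = {}"
    proof (rule equals0I)
      fix x assume "x \<in> p \<inter> q"
      then obtain i j where "i \<in> S" "x \<in> A i" "j \<in> {..<2 * k} - S" "x \<in> A j" using psub qsub by blast
      then show False using AA by blast
    qed
    moreover have "S = S0"
    proof
      show "S \<subseteq> S0" using l S(1) by (auto simp: S0_def)
      show "S0 \<subseteq> S"
      proof
        fix j assume "j \<in> S0"
        then obtain x where x: "x \<in> p" "x \<in> A j" "j < 2 * k" by (auto simp: S0_def)
        then obtain i where "i \<in> S" "x \<in> A i" using psub by blast
        then show "j \<in> S" using AA[of i j] x by (cases "j \<in> S") auto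
      qed
    qed
    moreover have "rainbow (2 * k) A (p \<union> q)" unfolding rainbow_def
    proof (intro allI impI)
      fix i assume "i < 2 * k"
      then show "(p \<union> q) \<inter> A i \<noteq> {}" using l by (cases "i \<in> S") blast+
    qed
    ultimately show ?r by blast
  next
    assume r: ?r
    have qmeets: "q \<inter> A i \<noteq> {}" if "i \<in> {..<2 * k} - S0" for i
      using r that by (auto simp: rainbow_def S0_def)
    have pmeets: "p \<inter> A i \<noteq> {}" if "i \<in> S0" for i using that by (simp add: S0_def)
    have S0: "S0 \<subseteq> {..<2 * k}" by (auto simp: S0_def)
    then have fin: "finite S0" using finite_subset by blast
    have "card S0 \<le> k"
      using disjoint_family_on_inter_card(2)[OF disj[OF S0] pq(1) pmeets] pq by simp
    moreover have "card ({..<2 * k} - S0) \<le> k"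
      using disjoint_family_on_inter_card(2)[OF disj[OF Diff_subset[of _ S0]] pq(2) qmeets] pq by simp
    moreover have "card ({..<2 * k} - S0) = 2 * k - card S0"
      using S0 fin by (simp add: card_Diff_subset)
    ultimately have "card S0 = k" by linarith
    then show ?l using r S0 fin pmeets qmeets by (auto simp: nsets_def)
  qed
  have "(\<Sum>S\<in>nsets {..<2 * k} k. meets A S p * meets A ({..<2 * k} - S) q) =
      (\<Sum>S\<in>nsets {..<2 * k} k. of_bool (p \<inter> q = {} \<and> rainbow (2 * k) A (p \<union> q) \<and> S = S0))"
  proof (intro sum.cong refl)
    fix S assume S: "S \<in> nsets {..<2 * k} k"
    have "meets A S p * meets A ({..<2 * k} - S) q =
        of_bool ((\<forall>i\<in>S. p \<inter> A i \<noteq> {}) \<and> (\<forall>i\<in>{..<2 * k} - S. q \<inter> A i \<noteq> {}))"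
      by (simp only: meets_def of_bool_conj)
    then show "meets A S p * meets A ({..<2 * k} - S) q =
        of_bool (p \<inter> q = {} \<and> rainbow (2 * k) A (p \<union> q) \<and> S = S0)"
      using key[of S] S by simp
  qed
  also have "\<dots> = of_bool (p \<inter> q = {} \<and> rainbow (2 * k) A (p \<union> q))"
  proof (cases "p \<inter> q = {} \<and> rainbow (2 * k) A (p \<union> q)")
    case True
    then have "S0 \<in> nsets {..<2 * k} k" using key by blast
    then show ?thesis using True by (simp add: finite_imp_finite_nsets sum.delta' of_bool_def)
  next
    case False
    then show ?thesis by (cases "p \<inter> q = {}") simp_all
  qed
  finally show ?thesis by simp
qed

lemma sum_Pow_alternating:
  assumes "finite X"
  shows "(\<Sum>T\<in>Pow X. (-1) ^ card T) = (of_bool (X = {}) :: real)"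
proof -
  have "(\<Sum>T\<in>Pow X. (-1) ^ card T) = (0 :: real) ^ card X"
    using prod_diff_conv_sum[OF assms, of "\<lambda>_. 1 :: real" "\<lambda>_. 1"] by simp
  then show ?thesis using assms by (simp add: power_0_left)
qed

text \<open>Expanding the indicator of \<open>p \<inter> q = {}\<close> over subsets
  \<open>T\<close> of \<open>p \<inter> q\<close> turns the form into the sum of
  \<open>(-1) ^ card T * (st T)\<^sup>2\<close>. Here \<open>st T\<close> is zero below size
  \<open>k\<close> by \<open>star\<close>, zero above it since no \<open>p\<close> contains
  \<open>T\<close>, and \<open>y T\<close> at size \<open>k\<close>.\<close>

lemma disjointness_form:
  fixes y :: "'a set \<Rightarrow> real"
  assumes V: "finite V"
    and star: "\<And>T. T \<subseteq> V \<Longrightarrow> card T < k \<Longrightarrow> (\<Sum>p\<in>nsets V k. of_bool (T \<subseteq> p) * y p) = 0"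
  shows "(\<Sum>p\<in>nsets V k. \<Sum>q\<in>nsets V k. of_bool (p \<inter> q = {}) * y p * y q) =
    (-1) ^ k * (\<Sum>p\<in>nsets V k. (y p)\<^sup>2)"
proof -
  let ?N = "nsets V k"
  define st where "st T = (\<Sum>p\<in>?N. of_bool (T \<subseteq> p) * y p)" for T
  have fin: "finite ?N" "finite (Pow V)" using V by (auto simp: finite_imp_finite_nsets)
  have pq: "of_bool (p \<inter> q = {}) = (\<Sum>T\<in>Pow V. (-1) ^ card T * (of_bool (T \<subseteq> p) * of_bool (T \<subseteq> q) :: real))"
    if "p \<in> ?N" for p q
  proof -
    have "p \<subseteq> V" "finite p" using that by (auto simp: nsets_def)
    then have "(\<Sum>T\<in>Pow (p \<inter> q). (-1) ^ card T) =
        (\<Sum>T\<in>Pow V. (-1) ^ card T * (of_bool (T \<subseteq> p) * of_bool (T \<subseteq> q) :: real))"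
      using fin by (intro sum.mono_neutral_cong_left) auto
    then show ?thesis using sum_Pow_alternating[of "p \<inter> q"] \<open>finite p\<close> by simp
  qed
  have "(\<Sum>p\<in>?N. \<Sum>q\<in>?N. of_bool (p \<inter> q = {}) * y p * y q) =
      (\<Sum>p\<in>?N. \<Sum>q\<in>?N. \<Sum>T\<in>Pow V. (-1) ^ card T * ((of_bool (T \<subseteq> p) * y p) * (of_bool (T \<subseteq> q) * y q)))"
    by (intro sum.cong refl) (simp only: pq sum_distrib_right, simp only: mult_ac)
  also have "\<dots> = (\<Sum>p\<in>?N. \<Sum>T\<in>Pow V. \<Sum>q\<in>?N. (-1) ^ card T * ((of_bool (T \<subseteq> p) * y p) * (of_bool (T \<subseteq> q) * y q)))"
    by (intro sum.cong refl sum.swap)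
  also have "\<dots> = (\<Sum>T\<in>Pow V. \<Sum>p\<in>?N. \<Sum>q\<in>?N. (-1) ^ card T * ((of_bool (T \<subseteq> p) * y p) * (of_bool (T \<subseteq> q) * y q)))"
    by (rule sum.swap)
  also have "\<dots> = (\<Sum>T\<in>Pow V. (-1) ^ card T * (st T * st T))"
    by (simp only: st_def sum_product, simp only: sum_distrib_left)
  also have "\<dots> = (\<Sum>T\<in>?N. (-1) ^ k * (y T)\<^sup>2)"
  proof (rule sum.mono_neutral_cong_right)
    show "?N \<subseteq> Pow V" by (auto simp: nsets_def)
    show "\<forall>T\<in>Pow V - ?N. (-1) ^ card T * (st T * st T) = 0"
    proof
      fix T assume T: "T \<in> Pow V - ?N"
      then have Tf: "T \<subseteq> V" "finite T" "card T \<noteq> k" using V by (auto simp: nsets_def finite_subset)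
      have "st T = 0"
      proof (cases "card T < k")
        case True
        then show ?thesis using star Tf by (simp add: st_def)
      next
        case False
        then have "\<not> T \<subseteq> p" if "p \<in> ?N" for p
          using that Tf card_mono[of p T] by (auto simp: nsets_def)
        then show ?thesis by (simp add: st_def)
      qed
      then show "(-1) ^ card T * (st T * st T) = 0" by simp
    qed
    fix T assume T: "T \<in> ?N"
    have "T \<subseteq> p \<longleftrightarrow> p = T" if "p \<in> ?N" for p
      using that T card_subset_eq[of p T] by (auto simp: nsets_def)
    then have "st T = (\<Sum>p\<in>?N. of_bool (p = T) * y p)" by (simp add: st_def)
    also have "\<dots> = (\<Sum>p\<in>?N. if p = T then y p else 0)" by (intro sum.cong) auto
    also have "\<dots> = y T" using T fin by (simp add: sum.delta)
    finally show "(-1) ^ card T * (st T * st T) = (-1) ^ k * (y T)\<^sup>2"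
      using T by (simp add: nsets_def power2_eq_square)
  qed (use fin in auto)
  finally show ?thesis by (simp add: sum_distrib_left)
qed

lemma sum_sum_list_swap:
  fixes f :: "'b \<Rightarrow> 'c \<Rightarrow> real"
  shows "(\<Sum>x\<in>X. \<Sum>A\<leftarrow>L. f x A) = (\<Sum>A\<leftarrow>L. \<Sum>x\<in>X. f x A)"
  by (induction L) (simp_all add: sum.distrib)

text \<open>Exact coverage writes the disjointness indicator as a real sum over the members of
  \<open>L\<close> and the index sets \<open>S\<close>. The form becomes a sum of products of the
  linear forms of \<open>S\<close> and its complement.\<close>

lemma disjointness_form_eq_0:
  fixes y :: "'a set \<Rightarrow> real"
  assumes "k > 0" and L: "\<forall>A\<in>set L. parts_in (2 * k) V A"
    and one: "\<forall>e\<in>nsets V (2 * k). coverage (2 * k) L e = 1"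
    and y: "\<And>A S. A \<in> set L \<Longrightarrow> S \<in> nsets {..<2 * k} k \<Longrightarrow> 0 \<in> S \<Longrightarrow>
      (\<Sum>p\<in>nsets V k. meets A S p * y p) = 0"
  shows "(\<Sum>p\<in>nsets V k. \<Sum>q\<in>nsets V k. of_bool (p \<inter> q = {}) * y p * y q) = 0"
proof -
  let ?N = "nsets V k" and ?I = "nsets {..<2 * k} k"
  have pq: "of_bool (p \<inter> q = {}) =
      (\<Sum>A\<leftarrow>L. \<Sum>S\<in>?I. meets A S p * meets A ({..<2 * k} - S) q)" if p: "p \<in> ?N" and q: "q \<in> ?N" for p q
  proof -
    have "(\<Sum>A\<leftarrow>L. \<Sum>S\<in>?I. meets A S p * meets A ({..<2 * k} - S) q) =
        (\<Sum>A\<leftarrow>L. of_bool (p \<inter> q = {} \<and> rainbow (2 * k) A (p \<union> q)))"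
      using rainbow_Un_eq_sum[OF _ p q] L by (intro arg_cong[of _ _ sum_list] map_cong) auto
    also have "\<dots> = of_bool (p \<inter> q = {})"
    proof (cases "p \<inter> q = {}")
      case True
      then have "p \<union> q \<in> nsets V (2 * k)"
        using p q by (auto simp: nsets_def card_Un_disjoint)
      then have "real (coverage (2 * k) L (p \<union> q)) = 1" using one by simp
      moreover have "real (coverage (2 * k) L e) = (\<Sum>A\<leftarrow>L. of_bool (rainbow (2 * k) A e))" for e
        by (induction L) auto
      ultimately show ?thesis using True by simp
    qed simp
    finally show ?thesis by simp
  qed
  have "(\<Sum>p\<in>?N. \<Sum>q\<in>?N. of_bool (p \<inter> q = {}) * y p * y q) =
      (\<Sum>p\<in>?N. \<Sum>q\<in>?N. \<Sum>A\<leftarrow>L. \<Sum>S\<in>?I. (meets A S p * y p) * (meets A ({..<2 * k} - S) q * y q))"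
    by (intro sum.cong refl)
       (simp only: pq sum_list_mult_const[symmetric] sum_distrib_right, simp only: mult_ac)
  also have "\<dots> = (\<Sum>A\<leftarrow>L. \<Sum>p\<in>?N. \<Sum>q\<in>?N. \<Sum>S\<in>?I. (meets A S p * y p) * (meets A ({..<2 * k} - S) q * y q))"
    by (simp only: sum_sum_list_swap)
  also have "\<dots> = (\<Sum>A\<leftarrow>L. 0)"
  proof (intro arg_cong[of _ _ sum_list] map_cong refl)
    fix A assume A: "A \<in> set L"
    have "(\<Sum>p\<in>?N. \<Sum>q\<in>?N. \<Sum>S\<in>?I. (meets A S p * y p) * (meets A ({..<2 * k} - S) q * y q)) =
        (\<Sum>p\<in>?N. \<Sum>S\<in>?I. \<Sum>q\<in>?N. (meets A S p * y p) * (meets A ({..<2 * k} - S) q * y q))"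
      by (intro sum.cong refl sum.swap)
    also have "\<dots> = (\<Sum>S\<in>?I. \<Sum>p\<in>?N. \<Sum>q\<in>?N. (meets A S p * y p) * (meets A ({..<2 * k} - S) q * y q))"
      by (rule sum.swap)
    also have "\<dots> = (\<Sum>S\<in>?I. (\<Sum>p\<in>?N. meets A S p * y p) * (\<Sum>q\<in>?N. meets A ({..<2 * k} - S) q * y q))"
      by (simp only: sum_product)
    also have "\<dots> = 0"
    proof (intro sum.neutral ballI)
      fix S assume S: "S \<in> ?I"
      then have S': "{..<2 * k} - S \<in> ?I" by (auto simp: nsets_def card_Diff_subset)
      \<comment> \<open>As \<open>k > 0\<close>, the index 0 lies in exactly one of \<open>S\<close>
        and its complement, so one factor vanishes by assumption.\<close>
      show "(\<Sum>p\<in>?N. meets A S p * y p) * (\<Sum>q\<in>?N. meets A ({..<2 * k} - S) q * y q) = 0"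
        using y[OF A S] y[OF A S'] \<open>k > 0\<close> by (cases "0 \<in> S") auto
    qed
    finally show "(\<Sum>p\<in>?N. \<Sum>q\<in>?N. \<Sum>S\<in>?I. (meets A S p * y p) * (meets A ({..<2 * k} - S) q * y q)) = 0" .
  qed
  finally show ?thesis by simp
qed

section \<open>Counting the linear conditions\<close>

lemma card_nsets:
  assumes "finite V"
  shows "card (nsets V k) = card V choose k"
proof -
  have "nsets V k = {B. B \<subseteq> V \<and> card B = k}" using assms finite_subset by (auto simp: nsets_def)
  then show ?thesis using n_subsets[OF assms] by simp
qed

text \<open>With fewer conditions than unknowns some nonzero \<open>y\<close> satisfies them all;
  its disjointness form is then both zero and, up to sign, a sum of squares. The case
  \<open>k = 1\<close> is the Graham-Pollak bound.\<close>

lemma exact_coverage_bound: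
  assumes V: "finite V" and "k > 0" and L: "\<forall>A\<in>set L. parts_in (2 * k) V A"
    and one: "\<forall>e\<in>nsets V (2 * k). coverage (2 * k) L e = 1"
  shows "card V choose k \<le> (\<Sum>j<k. card V choose j) + length L * ((2 * k - 1) choose (k - 1))"
proof (rule ccontr)
  let ?I = "{S \<in> nsets {..<2 * k} k. 0 \<in> S}"
  define TT where "TT = (\<Union>j<k. nsets V j)"
  have TT: "T \<in> TT" if "T \<subseteq> V" "card T < k" for T
    using that V by (auto simp: TT_def nsets_def finite_subset)
  have finT: "finite TT" using V by (auto simp: TT_def finite_imp_finite_nsets)
  have cardT: "card TT \<le> (\<Sum>j<k. card V choose j)"
    unfolding TT_def using card_UN_le[of "{..<k}" "nsets V"] V by (simp add: card_nsets)
  have finI: "finite ?I" by (simp add: finite_imp_finite_nsets)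
  \<comment> \<open>Deleting 0 from \<open>S\<close> leaves a \<open>(k - 1)\<close>-subset of the
    other \<open>2 * k - 1\<close> indices.\<close>
  have cardI: "card ?I \<le> (2 * k - 1) choose (k - 1)"
  proof -
    have "card ?I \<le> card (nsets {1..<2 * k} (k - 1))"
    proof (rule card_inj_on_le[where f = "\<lambda>S. S - {0}"])
      show "inj_on (\<lambda>S. S - {0}) ?I" by (auto simp: inj_on_def)
      show "(\<lambda>S. S - {0}) ` ?I \<subseteq> nsets {1..<2 * k} (k - 1)"
        by (auto simp: nsets_def Suc_le_eq intro: gr0I)
    qed (simp add: finite_imp_finite_nsets)
    then show ?thesis by (simp add: card_nsets)
  qed
  obtain ts where ts: "set ts = TT" "distinct ts" using finite_distinct_list[OF finT] by blast
  obtain ss where ss: "set ss = ?I" "distinct ss" using finite_distinct_list[OF finI] by blast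
  have length: "length ts = card TT" "length ss = card ?I"
    using distinct_card[OF ts(2)] distinct_card[OF ss(2)] ts(1) ss(1) by simp_all
  \<comment> \<open>The conditions: one for each set of fewer than \<open>k\<close> vertices, and
    one for each member of \<open>L\<close> together with an index set containing 0.\<close>
  define cs where "cs = map (\<lambda>T p. of_bool (T \<subseteq> p)) ts @ map (\<lambda>(A, S). meets A S) (List.product L ss)"
  assume "\<not> ?thesis"
  moreover have "length cs \<le> (\<Sum>j<k. card V choose j) + length L * ((2 * k - 1) choose (k - 1))"
    using cardT mult_le_mono2[OF cardI, of "length L"] length by (simp add: cs_def add_mono)
  ultimately have "length cs < card (nsets V k)" using V by (simp add: card_nsets)
  then obtain y where y: "\<exists>p\<in>nsets V k. y p \<noteq> 0"
    "\<And>c. c \<in> set cs \<Longrightarrow> (\<Sum>p\<in>nsets V k. c p * y p) = 0"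
    using exists_nonzero_solution[of "nsets V k" cs] V finite_imp_finite_nsets by blast
  have "(\<lambda>p. of_bool (T \<subseteq> p)) \<in> set cs" if "T \<in> TT" for T
    using that ts by (auto simp: cs_def)
  then have star: "(\<Sum>p\<in>nsets V k. of_bool (T \<subseteq> p) * y p) = 0" if "T \<subseteq> V" "card T < k" for T
    using y(2) TT[OF that] by blast
  have "meets A S \<in> set cs" if "A \<in> set L" "S \<in> ?I" for A S
    using that ss by (force simp: cs_def)
  then have "(\<Sum>p\<in>nsets V k. meets A S p * y p) = 0" if "A \<in> set L" "S \<in> nsets {..<2 * k} k" "0 \<in> S" for A S
    using y(2) that by blast
  from disjointness_form_eq_0[OF \<open>k > 0\<close> L one this] disjointness_form[OF V star]
  have "(\<Sum>p\<in>nsets V k. (y p)\<^sup>2) = 0" by simp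
  then show False using y(1) V by (simp add: sum_nonneg_eq_0_iff finite_imp_finite_nsets)
qed

subsection \<open>Partition numbers\<close>

text \<open>Singleton parts isolate each edge. This guarantees that the minimum defining
  \<open>partition_number\<close> is attained.\<close>

lemma exists_partite_partition:
  assumes V: "finite V"
  shows "\<exists>C. partite_partition r V C"
proof -
  have "is_complete_partite r V {e}" if e: "e \<in> nsets V r" for e
  proof -
    have e': "e \<subseteq> V" "finite e" "card e = r" using e by (auto simp: nsets_def)
    obtain g where g: "bij_betw g {..<r} e"
      using ex_bij_betw_nat_finite[OF e'(2)] e'(3) by (auto simp: atLeast0LessThan)
    have "e' = e" if "e' \<in> nsets V r" "\<forall>i<r. g i \<in> e'" for e'
    proof -
      have "e \<subseteq> e'" using g that(2) by (auto simp: bij_betw_def)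
      then show ?thesis using that(1) e' card_subset_eq[of e' e] by (auto simp: nsets_def)
    qed
    moreover have "\<forall>i<r. g i \<in> e" using g by (auto simp: bij_betw_def)
    moreover have "complete_partite r V (\<lambda>i. {g i}) = {e' \<in> nsets V r. \<forall>i<r. g i \<in> e'}"
      by (simp add: complete_partite_def)
    ultimately have "{e} = complete_partite r V (\<lambda>i. {g i})"
      using e by blast
    moreover have "parts_in r V (\<lambda>i. {g i})"
      using g e' by (auto simp: parts_in_def disjoint_family_on_def bij_betw_def inj_on_def)
    ultimately show ?thesis unfolding is_complete_partite_iff by blast
  qed
  then have "partite_partition r V ((\<lambda>e. {e}) ` nsets V r)"
    using V by (auto simp: partite_partition_def finite_imp_finite_nsets)
  then show ?thesis by blast
qed

lemma partition_number_family:
  obtains L where "length L = partition_number r n" "\<forall>A\<in>set L. parts_in r {..<n} A"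
    "\<forall>e\<in>nsets {..<n} r. coverage r L e = 1"
proof -
  have "\<exists>C. partite_partition r {..<n} C \<and> card C = partition_number r n"
    unfolding partition_number_def
    by (rule LeastI_ex) (use exists_partite_partition[of "{..<n}" r] in blast)
  then obtain C where C: "partite_partition r {..<n} C" "card C = partition_number r n" by blast
  have fin: "finite C" using C(1) by (auto simp: partite_partition_def)
  then obtain xs where xs: "set xs = C" "distinct xs" using finite_distinct_list by blast
  have "\<forall>H\<in>C. \<exists>A. parts_in r {..<n} A \<and> H = complete_partite r {..<n} A"
    using C(1) by (auto simp: partite_partition_def is_complete_partite_iff)
  then obtain g where g: "\<And>H. H \<in> C \<Longrightarrow> parts_in r {..<n} (g H)"
    "\<And>H. H \<in> C \<Longrightarrow> H = complete_partite r {..<n} (g H)" by metis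
  have "coverage r (map g xs) e = 1" if e: "e \<in> nsets {..<n} r" for e
  proof -
    have "coverage r (map g xs) e = (\<Sum>H\<in>C. of_bool (rainbow r (g H) e))"
      using xs by (simp add: coverage_def o_def sum_list_distinct_conv_sum_set)
    also have "\<dots> = (\<Sum>H\<in>C. of_bool (e \<in> H))"
    proof (intro sum.cong refl arg_cong[where f = of_bool])
      fix H assume "H \<in> C"
      then have "e \<in> H \<longleftrightarrow> e \<in> complete_partite r {..<n} (g H)"
        using arg_cong[OF g(2), of H "\<lambda>X. e \<in> X"] by blast
      then show "rainbow r (g H) e \<longleftrightarrow> e \<in> H" using e by (simp add: mem_complete_partite)
    qed
    also have "\<dots> = card {H \<in> C. e \<in> H}" using fin by (simp add: Int_def)
    also have "\<dots> = 1"
    proof -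
      obtain H where "H \<in> C" "e \<in> H" "\<And>H'. H' \<in> C \<Longrightarrow> e \<in> H' \<Longrightarrow> H' = H"
        using C(1) e unfolding partite_partition_def by metis
      then have "{H \<in> C. e \<in> H} = {H}" by blast
      then show ?thesis by simp
    qed
    finally show ?thesis .
  qed
  moreover have "length (map g xs) = partition_number r n"
    using xs C(2) by (simp add: distinct_card[symmetric])
  ultimately show thesis using that[of "map g xs"] xs g(1) by auto
qed

text \<open>The link of the last vertex \<open>m\<close> covers every pair of the other
  \<open>n - 1\<close> vertices exactly once, so the bound for \<open>k = 1\<close> applies.\<close>

lemma partition_number_3_ge: "n \<le> partition_number 3 n + 2"
proof (cases n)
  case (Suc m)
  obtain L where L: "length L = partition_number 3 n" "\<forall>A\<in>set L. parts_in 3 {..<n} A"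
    "\<forall>e\<in>nsets {..<n} 3. coverage 3 L e = 1" by (rule partition_number_family)
  have ins: "{..<n} = insert m {..<m}" using Suc by auto
  have L': "\<forall>A\<in>set L. parts_in (Suc 2) (insert m {..<m}) A"
    using L(2) unfolding ins by (simp add: numeral_3_eq_3 numeral_2_eq_2)
  have "coverage 2 (link 2 m L) e = 1" if e: "e \<in> nsets {..<m} 2" for e
  proof -
    have "insert m e \<in> nsets {..<n} 3" using e Suc by (auto simp: nsets_def card_insert_if)
    then show ?thesis using link_family(2)[OF L' _ e] L(3) by (simp add: numeral_3_eq_3 numeral_2_eq_2)
  qed
  then have "m \<le> 1 + length (link 2 m L)"
    using exact_coverage_bound[of "{..<m}" 1 "link 2 m L"] link_family(1)[OF L'] by simp
  also have "length (link 2 m L) \<le> length L" by (simp add: link_def)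
  finally show ?thesis using L(1) Suc by simp
qed simp

lemma partition_number_4_ge: "n choose 2 \<le> 1 + n + 3 * partition_number 4 n"
proof -
  obtain L where L: "length L = partition_number 4 n" "\<forall>A\<in>set L. parts_in 4 {..<n} A"
    "\<forall>e\<in>nsets {..<n} 4. coverage 4 L e = 1" by (rule partition_number_family)
  have "(\<Sum>j<2. n choose j) = 1 + n" by (simp add: numeral_2_eq_2)
  moreover have "(2 * 2 - 1) choose (2 - 1) = (3::nat)" by simp
  ultimately show ?thesis
    using exact_coverage_bound[of "{..<n}" 2 L] L by simp
qed

section \<open>Comparison of the upper and lower bounds\<close>

theorem mainTheorem7:
  shows "(\<forall>n::nat. n \<ge> 6 \<longrightarrow>
            int (odd_cover_number 3 n) \<le> \<lceil>real n / 2\<rceil> \<and>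
            \<lceil>real n / 2\<rceil> < int (partition_number 3 n)) \<and>
         (\<exists>N::nat. \<forall>n\<ge>N. odd_cover_number 4 n < partition_number 4 n)"
proof (intro conjI allI impI)
  fix n :: nat assume n: "n \<ge> 6"
  have half: "\<lceil>real n / 2\<rceil> = int ((n + 1) div 2)"
  proof (rule ceiling_unique)
    have "n \<le> 2 * ((n + 1) div 2)" "2 * ((n + 1) div 2) \<le> n + 1" by presburger+
    then have "real n \<le> 2 * real ((n + 1) div 2)" "2 * real ((n + 1) div 2) \<le> real n + 1"
      by linarith+
    then show "real_of_int (int ((n + 1) div 2)) - 1 < real n / 2"
      "real n / 2 \<le> real_of_int (int ((n + 1) div 2))" by simp_all
  qed
  show "int (odd_cover_number 3 n) \<le> \<lceil>real n / 2\<rceil>"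
    using odd_cover_number_le[OF odd_coverable_3[of "{..<n}"]] half by simp
  \<comment> \<open>The lower bound \<open>n - 2\<close> exceeds \<open>(n + 1) div 2\<close> from
    \<open>n = 6\<close> on; at \<open>n = 5\<close> both equal 3.\<close>
  show "\<lceil>real n / 2\<rceil> < int (partition_number 3 n)"
    using partition_number_3_ge[of n] n half by simp
next
  \<comment> \<open>Comparing \<open>(n^2 + 217 n - 210) / 7\<close> with
    \<open>(n^2 - 3 n - 2) / 6\<close> reduces to \<open>1323 n - 1246 < n^2\<close>, which 2000
    satisfies with room to spare.\<close>
  have "odd_cover_number 4 n < partition_number 4 n" if n: "n \<ge> 2000" for n
  proof -
    obtain t where t: "odd_coverable 4 {..<n} t" "real t \<le> (real n)\<^sup>2 / 7 + 31 * real n - 30"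
      using odd_coverable_4[of "{..<n}"] n by (auto simp: lessThan_empty_iff)
    have "2 * real (n choose 2) = (real n)\<^sup>2 - real n"
      using n by (simp add: choose_two real_of_nat_div of_nat_diff power2_eq_square field_simps)
    moreover have "real (n choose 2) \<le> 1 + real n + 3 * real (partition_number 4 n)"
      using partition_number_4_ge[of n] by linarith
    ultimately have "(real n)\<^sup>2 \<le> 2 + 3 * real n + 6 * real (partition_number 4 n)" by linarith
    moreover have "2000 * real n \<le> (real n)\<^sup>2"
      unfolding power2_eq_square using n by (intro mult_right_mono) auto
    moreover have "2000 \<le> real n" using n by simp
    moreover have "7 * real t \<le> (real n)\<^sup>2 + 217 * real n - 210" using t(2) by simp
    ultimately have "real t < real (partition_number 4 n)" by linarith
    then show ?thesis using odd_cover_number_le[OF t(1)] by linarith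
  qed
  then show "\<exists>N::nat. \<forall>n\<ge>N. odd_cover_number 4 n < partition_number 4 n" by blast
qed

end
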